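(* Let $N\ge1$ and $s\in(0,1)$, and let $\beta_2=(N+2-2s)^{-1}$. Let $\Phi\ge 0$ be a solution on $\mathbb{R}^N$ of $$\nabla\cdot\big(\Phi\,\nabla(-\Delta)^{-s}\Phi\big)=-\beta_2\,\nabla\cdot(y\,\Phi).$$ Let $\hat m>1$, $\hat s=s$, and $\beta_3=\frac{1}{N(\hat m-1)+2-2\hat s}$. Define $\phi_3\ge0$ by $$\phi_3^{\hat m-1}=(\beta_3/\beta_2)\,\Phi.$$ Then $\phi_3$ is a solution of $$\nabla\cdot\big(\phi_3\,\nabla(-\Delta)^{-\hat s}\phi_3^{\hat m-1}\big)=-\beta_3\,\nabla\cdot(y\,\phi_3).$$ In particular, $\operatorname{supp}\phi_3=\operatorname{supp}\Phi$ for every $\hat m>1$.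
   Context: For $0<\sigma<1$, $(-\Delta)^{-\sigma}$ denotes the inverse of the fractional Laplacian on $\mathbb{R}^N$, i.e. the operator with Fourier symbol $|\xi|^{-2\sigma}$ (Riesz potential). Profiles are nonnegative functions, regular enough and decaying at infinity so that the equations make sense. The second equation is the profile equation of mass-conserving self-similar solutions $w=t^{-N\beta_3}\phi_3(xt^{-\beta_3})$ of $w_t=\nabla\cdot(w\nabla(-\Delta)^{-\hat s}w^{\hat m-1})$. *)

theory Defs
  imports "HOL-Analysis.Analysis"
begin

definition support :: "('a::euclidean_space \<Rightarrow> real) \<Rightarrow> 'a set" where
  "support f = closure {x. f x \<noteq> 0}"

definition grad :: "('a::euclidean_space \<Rightarrow> real) \<Rightarrow> 'a \<Rightarrow> 'a" where
  "grad u x = (\<Sum>b\<in>Basis. frechet_derivative u (at x) b *\<^sub>R b)"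

fun iter_partial :: "'a::euclidean_space list \<Rightarrow> ('a \<Rightarrow> real) \<Rightarrow> 'a \<Rightarrow> real" where
  "iter_partial [] f = f"
| "iter_partial (v # vs) f = (\<lambda>x. frechet_derivative (iter_partial vs f) (at x) v)"

definition test_function :: "('a::euclidean_space \<Rightarrow> real) \<Rightarrow> bool" where
  "test_function \<psi> \<longleftrightarrow>
     (\<forall>vs. set vs \<subseteq> Basis \<longrightarrow> (\<forall>x. iter_partial vs \<psi> differentiable (at x)))
     \<and> compact (support \<psi>)"

text \<open>Kernel of the Riesz potential (-Delta)^(-s) on R^N, i.e. of the operator with
  Fourier symbol |xi|^(-2s).  For N > 2s this is the standard kernel
  c_{N,s} |z|^(2s-N) with c_{N,s} = Gamma(N/2-s)/(4^s pi^(N/2) Gamma(s)).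
  In the remaining case N = 1, 1/2 <= s < 1 the kernel is only defined up to an
  additive constant and the usual renormalised kernels are used
  (c_{1,s}(|z|^(2s-1) - |y|^(2s-1)) for s > 1/2, -(1/pi)(ln|z| - ln|y|) for s = 1/2);
  only the gradient of the potential enters the equations.\<close>
definition riesz_kernel :: "nat \<Rightarrow> real \<Rightarrow> 'a::euclidean_space \<Rightarrow> 'a \<Rightarrow> real" where
  "riesz_kernel N s z y =
    (if real N > 2 * s then
       Gamma (real N / 2 - s) / (4 powr s * pi powr (real N / 2) * Gamma s)
         * norm z powr (2 * s - real N)
     else if 2 * s = 1 then
       - (1 / pi) * (ln (norm z) - ln (norm y))
     else
       Gamma (1 / 2 - s) / (4 powr s * sqrt pi * Gamma s)
         * (norm z powr (2 * s - 1) - norm y powr (2 * s - 1)))"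

definition riesz_potential :: "real \<Rightarrow> ('a::euclidean_space \<Rightarrow> real) \<Rightarrow> 'a \<Rightarrow> real" where
  "riesz_potential s f x =
     (\<integral>y. riesz_kernel DIM('a) s (x - y) y * f y \<partial>lebesgue)"

text \<open>phi is a (weak) solution of
  div (phi grad (-Delta)^(-s) g) = - beta div (y phi)
  i.e. for every test function psi:
  integral of phi (grad P g + beta y) . grad psi = 0, where P g = (-Delta)^(-s) g.
  "Regular enough": the Riesz potential integral converges absolutely at every point,
  the pressure P g is continuously differentiable, and the weak integrand is integrable.\<close>
definition profile_solution ::
  "real \<Rightarrow> real \<Rightarrow> ('a::euclidean_space \<Rightarrow> real) \<Rightarrow> ('a \<Rightarrow> real) \<Rightarrow> bool" where
  "profile_solution s \<beta> \<phi> g \<longleftrightarrow>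
     (\<forall>x. integrable lebesgue (\<lambda>y. riesz_kernel DIM('a) s (x - y) y * g y))
   \<and> (\<forall>x. riesz_potential s g differentiable (at x))
   \<and> continuous_on UNIV (grad (riesz_potential s g))
   \<and> (\<forall>\<psi>. test_function \<psi> \<longrightarrow>
        integrable lebesgue
          (\<lambda>y. \<phi> y * ((grad (riesz_potential s g) y + \<beta> *\<^sub>R y) \<bullet> grad \<psi> y))
      \<and> (\<integral>y. \<phi> y * ((grad (riesz_potential s g) y + \<beta> *\<^sub>R y) \<bullet> grad \<psi> y) \<partial>lebesgue) = 0)"

end

(* A solution is stationary pointwise: the weak equation says that the flux \<Phi> grad u is divergence
  free, where u(y) = ((-Delta)^(-s) \<Phi>)(y) + \<beta>2 |y|^2 / 2.  Since the potential is bounded below by an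
  affine function of |y|, u is coercive, so the C^1 function (max 0 (M - u))^2 has compact support.
  After mollification it may be used for testing, and it gives that the integral of
  \<Phi> max 0 (M - u) |grad u|^2 vanishes for every M, hence \<Phi> grad u = 0 everywhere.  Multiplying the
  pressure by \<beta>3 / \<beta>2 turns grad u into \<beta>3 / \<beta>2 grad u, which vanishes wherever \<phi>3 does not;
  thus the flux of \<phi>3 is zero as well. *)

theory Submission
  imports Defs
begin

section \<open>Smooth bump functions and an algebra closed under differentiation\<close>

text \<open>The classical flat function \<open>exp (-1/t)\<close> extended by zero, together with
  its multiples by powers of \<open>1/t\<close>. The index \<open>k\<close> is there because
  differentiation leads from one member to a linear combination of others, so the family controls
  all orders at once.\<close>

definition exp_bump :: "nat \<Rightarrow> real \<Rightarrow> real" where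
  "exp_bump k t = (if t \<le> 0 then 0 else exp (- inverse t) * inverse t ^ k)"

lemma exp_bump_tendsto_0: "((\<lambda>t. exp (- inverse t) * inverse t ^ k) \<longlongrightarrow> 0) (at_right (0::real))"
proof -
  have "((\<lambda>t. inverse t ^ k / exp (inverse t)) \<longlongrightarrow> 0) (at_right (0::real))"
    by (rule filterlim_compose[OF tendsto_power_div_exp_0 filterlim_inverse_at_top_right])
  then show ?thesis by (simp add: exp_minus field_simps)
qed

lemma exp_bump_has_derivative:
  "(exp_bump k has_real_derivative exp_bump (k + 2) t - real k * exp_bump (k + 1) t) (at t)"
proof -
  consider "t < 0" | "t > 0" | "t = 0" by linarith
  then show ?thesis
  proof cases
    case 1
    have "((\<lambda>_. 0) has_real_derivative 0) (at t)" by simp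
    then have "(exp_bump k has_real_derivative 0) (at t)"
      by (rule has_field_derivative_transform_within_open[of _ _ _ "{..<0}"])
         (use 1 in \<open>auto simp: exp_bump_def\<close>)
    then show ?thesis using 1 by (simp add: exp_bump_def)
  next
    case 2
    \<comment> \<open>The truncated exponent \<open>k - 1\<close> is wrong only for
      \<open>k = 0\<close>, where the factor \<open>real k\<close> kills the term.\<close>
    have k: "real k * y ^ (k - 1) * y\<^sup>2 = real k * y ^ (k + 1)" for y :: real
      by (cases k) (simp_all add: power2_eq_square)
    have "((\<lambda>t. exp (- inverse t) * inverse t ^ k) has_real_derivative
        exp (- inverse t) * (inverse t)\<^sup>2 * inverse t ^ k
        - exp (- inverse t) * (real k * inverse t ^ (k - 1) * (inverse t)\<^sup>2)) (at t)"
      using 2 by (auto intro!: derivative_eq_intros simp: power2_eq_square)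
    also have "exp (- inverse t) * (inverse t)\<^sup>2 * inverse t ^ k
        - exp (- inverse t) * (real k * inverse t ^ (k - 1) * (inverse t)\<^sup>2)
        = exp_bump (k + 2) t - real k * exp_bump (k + 1) t"
      using 2 unfolding k by (simp add: exp_bump_def power2_eq_square)
    finally have "((\<lambda>t. exp (- inverse t) * inverse t ^ k) has_real_derivative
        exp_bump (k + 2) t - real k * exp_bump (k + 1) t) (at t)" .
    then show ?thesis
      by (rule has_field_derivative_transform_within_open[of _ _ _ "{0<..}"])
         (use 2 in \<open>auto simp: exp_bump_def\<close>)
  next
    case 3
    \<comment> \<open>To the right of 0 the difference quotient is the same expression with exponent
      \<open>k + 1\<close>, so flatness for the next index gives the derivative 0.\<close>
    have r: "((\<lambda>h. exp_bump k h / h) \<longlongrightarrow> 0) (at_right 0)"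
      by (rule Lim_transform_eventually[OF exp_bump_tendsto_0[of "Suc k"]])
         (auto simp: eventually_at_filter exp_bump_def field_simps)
    have l: "((\<lambda>h. exp_bump k h / h) \<longlongrightarrow> 0) (at_left 0)"
      by (rule Lim_transform_eventually[OF tendsto_const])
         (auto simp: eventually_at_filter exp_bump_def)
    have "((\<lambda>h. exp_bump k h / h) \<longlongrightarrow> 0) (at 0)"
      using l r by (simp add: filterlim_split_at)
    then show ?thesis using 3 unfolding DERIV_def by (simp add: exp_bump_def)
  qed
qed

text \<open>Polynomials in the coordinates and in radial bumps centred at the origin. Closure under
  partial derivatives yields smoothness to all orders without any formula for higher
  derivatives.\<close>

inductive_set bump_algebra :: "real \<Rightarrow> ('a::euclidean_space \<Rightarrow> real) set" for r where
  const: "(\<lambda>_. c) \<in> bump_algebra r"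
| coord: "(\<lambda>x. x \<bullet> v) \<in> bump_algebra r"
| bump: "(\<lambda>x. exp_bump k (r - x \<bullet> x)) \<in> bump_algebra r"
| add: "f \<in> bump_algebra r \<Longrightarrow> g \<in> bump_algebra r \<Longrightarrow> (\<lambda>x. f x + g x) \<in> bump_algebra r"
| mult: "f \<in> bump_algebra r \<Longrightarrow> g \<in> bump_algebra r \<Longrightarrow> (\<lambda>x. f x * g x) \<in> bump_algebra r"

text \<open>Induction over the generators by the chain, sum and product rules. Membership of each
  directional derivative in the algebra is carried along so that differentiation can be
  repeated.\<close>

lemma bump_algebra_has_derivative:
  assumes "f \<in> bump_algebra r"
  shows "\<exists>f'. (\<forall>x. (f has_derivative f' x) (at x)) \<and> (\<forall>v. (\<lambda>x. f' x v) \<in> bump_algebra r)"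
  using assms
proof induction
  case (const c)
  show ?case by (rule exI[of _ "\<lambda>_ _. 0"]) (auto intro: bump_algebra.const)
next
  case (coord v)
  show ?case
    by (rule exI[of _ "\<lambda>_ h. h \<bullet> v"])
       (auto intro!: bump_algebra.const derivative_eq_intros)
next
  case (bump k)
  \<comment> \<open>Written with sums and products only, so that for fixed \<open>h\<close> the
    introduction rules of the algebra match it literally.\<close>
  let ?f' = "\<lambda>x h. (exp_bump (k + 2) (r - x \<bullet> x) + (- real k) * exp_bump (k + 1) (r - x \<bullet> x)) * ((-2) * (x \<bullet> h))"
  have "((\<lambda>x. exp_bump k (r - x \<bullet> x)) has_derivative ?f' x) (at x)" for x :: 'a
  proof -
    have "((\<lambda>x. r - x \<bullet> x) has_derivative (\<lambda>h. (-2) * (x \<bullet> h))) (at x)"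
      by (auto intro!: derivative_eq_intros simp: inner_commute)
    from has_derivative_compose[OF this exp_bump_has_derivative[of k "r - x \<bullet> x", unfolded has_field_derivative_def]]
    show ?thesis by simp
  qed
  moreover have "(\<lambda>x. ?f' x v) \<in> bump_algebra r" for v :: 'a
    by (intro bump_algebra.intros)
  ultimately show ?case by (intro exI[of _ ?f']) simp
next
  case (add f g)
  then obtain f' g' where "\<forall>x. (f has_derivative f' x) (at x)" "\<forall>v. (\<lambda>x. f' x v) \<in> bump_algebra r"
    "\<forall>x. (g has_derivative g' x) (at x)" "\<forall>v. (\<lambda>x. g' x v) \<in> bump_algebra r" by blast
  then show ?case
    by (intro exI[of _ "\<lambda>x h. f' x h + g' x h"])
       (auto intro!: derivative_eq_intros bump_algebra.add)
next
  case (mult f g)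
  then obtain f' g' where "\<forall>x. (f has_derivative f' x) (at x)" "\<forall>v. (\<lambda>x. f' x v) \<in> bump_algebra r"
    "\<forall>x. (g has_derivative g' x) (at x)" "\<forall>v. (\<lambda>x. g' x v) \<in> bump_algebra r" by blast
  then show ?case using mult.hyps
    by (intro exI[of _ "\<lambda>x h. f x * g' x h + f' x h * g x"])
       (auto intro!: derivative_eq_intros bump_algebra.add bump_algebra.mult)
qed

lemma iter_partial_bump_algebra:
  assumes "f \<in> bump_algebra r"
  shows "iter_partial vs f \<in> bump_algebra r"
proof (induction vs)
  case (Cons v vs)
  obtain f' where *: "\<And>x. (iter_partial vs f has_derivative f' x) (at x)" "\<And>v. (\<lambda>x. f' x v) \<in> bump_algebra r"
    using bump_algebra_has_derivative[OF Cons] by blast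
  have "(\<lambda>x. frechet_derivative (iter_partial vs f) (at x) v) = (\<lambda>x. f' x v)"
    by (metis * frechet_derivative_at)
  then show ?case using * by simp
qed (use assms in simp)

lemma bump_algebra_differentiable: "f \<in> bump_algebra r \<Longrightarrow> f differentiable (at x)"
  using bump_algebra_has_derivative unfolding differentiable_def by blast

section \<open>Gradients, smoothness and convolution over boxes\<close>

lemma grad_inner:
  assumes "f differentiable (at x)"
  shows "(f has_derivative (\<lambda>h. grad f x \<bullet> h)) (at x)"
proof -
  have l: "linear (frechet_derivative f (at x))"
    using assms by (simp add: linear_frechet_derivative)
  have "frechet_derivative f (at x) = (\<lambda>h. grad f x \<bullet> h)"
  proof
    fix h
    have "frechet_derivative f (at x) h = frechet_derivative f (at x) (\<Sum>b\<in>Basis. (h \<bullet> b) *\<^sub>R b)"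
      by (simp add: euclidean_representation)
    also have "\<dots> = (\<Sum>b\<in>Basis. (h \<bullet> b) * frechet_derivative f (at x) b)"
      by (simp add: linear_sum[OF l] linear_scale[OF l])
    also have "\<dots> = grad f x \<bullet> h"
      by (simp add: grad_def inner_sum_left inner_commute[of h] mult.commute)
    finally show "frechet_derivative f (at x) h = grad f x \<bullet> h" .
  qed
  then show ?thesis using assms by (simp add: frechet_derivative_works)
qed

lemma grad_eqI:
  assumes "(f has_derivative (\<lambda>h. v \<bullet> h)) (at x)"
  shows "grad f x = v"
proof -
  have "frechet_derivative f (at x) = (\<lambda>h. v \<bullet> h)"
    using frechet_derivative_at[OF assms] by simp
  then show ?thesis by (simp add: grad_def euclidean_representation)
qed

text \<open>The regularity half of \<open>test_function\<close>, kept apart because convolution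
  handles regularity and support by different arguments.\<close>

definition smooth :: "('a::euclidean_space \<Rightarrow> real) \<Rightarrow> bool" where
  "smooth f \<longleftrightarrow> (\<forall>vs. set vs \<subseteq> Basis \<longrightarrow> (\<forall>x. iter_partial vs f differentiable (at x)))"

lemma continuous_on_differentiable:
  "(\<And>x. f differentiable (at x)) \<Longrightarrow> continuous_on UNIV f"
  by (simp add: continuous_at_imp_continuous_on differentiable_imp_continuous_within)

text \<open>The components of the gradient are iterated partials of one order more; these are
  differentiable, hence continuous. This C^1 information is what differentiation under the integral
  needs.\<close>

lemma smooth_iter_partial_C1:
  assumes "smooth f" "set vs \<subseteq> Basis"
  shows "((iter_partial vs f) has_derivative (\<lambda>h. grad (iter_partial vs f) x \<bullet> h)) (at x)"
    and "continuous_on UNIV (grad (iter_partial vs f))"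
proof -
  show "((iter_partial vs f) has_derivative (\<lambda>h. grad (iter_partial vs f) x \<bullet> h)) (at x)"
    using assms by (intro grad_inner) (simp add: smooth_def)
  have "continuous_on UNIV (iter_partial (b # vs) f)" if "b \<in> Basis" for b
    using assms that unfolding smooth_def by (intro continuous_on_differentiable) (metis insert_subset list.set(2))
  then show "continuous_on UNIV (grad (iter_partial vs f))"
    unfolding grad_def by (auto intro!: continuous_intros)
qed

text \<open>Leibniz rule with all derivatives on \<open>f\<close>, so \<open>g\<close> need only be
  continuous. Integrating over a fixed box leaves only continuous integrands on a compact
  set.\<close>

lemma convolution_has_derivative:
  fixes f g :: "'a::euclidean_space \<Rightarrow> real"
  assumes f: "\<And>x. (f has_derivative (\<lambda>h. G x \<bullet> h)) (at x)"
    and G: "continuous_on UNIV G" and g: "continuous_on UNIV g"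
  shows "((\<lambda>x. integral (cbox a b) (\<lambda>t. g t * f (x - t))) has_derivative
           (\<lambda>h. integral (cbox a b) (\<lambda>t. g t *\<^sub>R G (x - t)) \<bullet> h)) (at x)"
proof -
  have fc: "continuous_on UNIV f"
    using f by (intro continuous_on_differentiable) (auto simp: differentiable_def)
  have int: "(\<lambda>t. g t *\<^sub>R G (x - t)) integrable_on cbox a b"
    by (intro integrable_continuous continuous_intros continuous_on_compose2[OF G]
        continuous_on_subset[OF g]) auto
  \<comment> \<open>The Leibniz rule wants the derivative as a bounded linear map, hence the
    wrapping of the gradient in \<open>blinfun_inner_right\<close>; it is pulled out of the integral
    afterwards by linearity.\<close>
  have "((\<lambda>x. integral (cbox a b) (\<lambda>t. g t * f (x - t))) has_derivative
      blinfun_apply (integral (cbox a b) (\<lambda>t. blinfun_inner_right (g t *\<^sub>R G (x - t))))) (at x)"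
  proof (rule leibniz_rule)
    fix y t :: 'a
    have "((\<lambda>x. x - t) has_derivative (\<lambda>h. h)) (at y)"
      by (auto intro!: derivative_eq_intros)
    from has_derivative_compose[OF this f[of "y - t"]]
    have "((\<lambda>x. f (x - t)) has_derivative (\<lambda>h. G (y - t) \<bullet> h)) (at y)" .
    then show "((\<lambda>x. g t * f (x - t)) has_derivative blinfun_apply (blinfun_inner_right (g t *\<^sub>R G (y - t)))) (at y)"
      by (auto intro!: derivative_eq_intros)
  next
    fix y :: 'a
    show "(\<lambda>t. g t * f (y - t)) integrable_on cbox a b"
      by (intro integrable_continuous continuous_intros continuous_on_compose2[OF fc]
          continuous_on_subset[OF g]) auto
  next
    show "continuous_on (UNIV \<times> cbox a b) (\<lambda>(x, t). blinfun_inner_right (g t *\<^sub>R G (x - t)))"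
      unfolding split_beta
      by (intro bounded_linear.continuous_on[OF bounded_linear_blinfun_inner_right]
          continuous_intros continuous_on_compose2[OF G] continuous_on_compose2[OF g]) auto
  qed auto
  moreover have "integral (cbox a b) (\<lambda>t. blinfun_inner_right (g t *\<^sub>R G (x - t)))
      = blinfun_inner_right (integral (cbox a b) (\<lambda>t. g t *\<^sub>R G (x - t)))"
    using integral_linear[OF int bounded_linear_blinfun_inner_right] by (simp add: o_def)
  ultimately show ?thesis by simp
qed

lemma iter_partial_convolution:
  fixes f g :: "'a::euclidean_space \<Rightarrow> real"
  assumes f: "smooth f" and g: "continuous_on UNIV g" and "set vs \<subseteq> Basis"
  shows "iter_partial vs (\<lambda>x. integral (cbox a b) (\<lambda>t. g t * f (x - t)))
       = (\<lambda>x. integral (cbox a b) (\<lambda>t. g t * iter_partial vs f (x - t)))"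
  using assms(3)
proof (induction vs)
  case (Cons v vs)
  let ?F = "iter_partial vs f"
  have vs: "set vs \<subseteq> Basis" using Cons.prems by simp
  note d = smooth_iter_partial_C1[OF f vs]
  show ?case
  proof
    fix x
    have int: "(\<lambda>t. g t *\<^sub>R grad ?F (x - t)) integrable_on cbox a b"
      by (intro integrable_continuous continuous_intros continuous_on_compose2[OF d(2)]
          continuous_on_subset[OF g]) auto
    have "iter_partial (v # vs) (\<lambda>x. integral (cbox a b) (\<lambda>t. g t * f (x - t))) x
        = integral (cbox a b) (\<lambda>t. g t *\<^sub>R grad ?F (x - t)) \<bullet> v"
      using Cons.IH[OF vs] frechet_derivative_at[OF convolution_has_derivative[OF d g, of a b x], symmetric]
      by simp
    also have "\<dots> = integral (cbox a b) (\<lambda>t. (g t *\<^sub>R grad ?F (x - t)) \<bullet> v)"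
      using integral_linear[OF int bounded_linear_inner_left[of v]] by (simp add: o_def)
    also have "\<dots> = integral (cbox a b) (\<lambda>t. g t * iter_partial (v # vs) f (x - t))"
      using frechet_derivative_at[OF d(1)] by (simp add: fun_eq_iff)
    finally show "iter_partial (v # vs) (\<lambda>x. integral (cbox a b) (\<lambda>t. g t * f (x - t))) x
      = integral (cbox a b) (\<lambda>t. g t * iter_partial (v # vs) f (x - t))" .
  qed
qed simp

lemma smooth_convolution:
  fixes f g :: "'a::euclidean_space \<Rightarrow> real"
  assumes f: "smooth f" and g: "continuous_on UNIV g"
  shows "smooth (\<lambda>x. integral (cbox a b) (\<lambda>t. g t * f (x - t)))"
  unfolding smooth_def
proof (intro allI impI)
  fix vs :: "'a list" and x :: 'a assume vs: "set vs \<subseteq> Basis"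
  show "iter_partial vs (\<lambda>x. integral (cbox a b) (\<lambda>t. g t * f (x - t))) differentiable (at x)"
    unfolding iter_partial_convolution[OF f g vs]
    using convolution_has_derivative[OF smooth_iter_partial_C1[OF f vs] g]
    by (auto simp: differentiable_def)
qed

text \<open>Substitution of \<open>x - t\<close> for \<open>t\<close>. The reflected box depends on
  \<open>x\<close>, so both integrals are extended by zero to the whole space and compared
  there.\<close>

lemma convolution_commute:
  fixes f g :: "'a::euclidean_space \<Rightarrow> real"
  assumes f: "continuous_on UNIV f" and g: "continuous_on UNIV g"
    and f0: "\<And>t. t \<notin> cbox a b \<Longrightarrow> f t = 0" and g0: "\<And>t. t \<notin> cbox c d \<Longrightarrow> g t = 0"
  shows "integral (cbox a b) (\<lambda>t. f t * g (x - t)) = integral (cbox c d) (\<lambda>t. g t * f (x - t))"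
proof -
  have "(\<lambda>t. f t * g (x - t)) integrable_on cbox a b"
    by (intro integrable_continuous continuous_intros continuous_on_compose2[OF g]
          continuous_on_subset[OF f]) auto
  then have "((\<lambda>t. f t * g (x - t)) has_integral integral (cbox a b) (\<lambda>t. f t * g (x - t))) (cbox a b)"
    by (rule integrable_integral)
  from has_integral_shift_cbox[OF has_integral_reflect_lemma[OF this], of "-x"]
  have "((\<lambda>t. g t * f (x - t)) has_integral integral (cbox a b) (\<lambda>t. f t * g (x - t))) (cbox (x - b) (x - a))"
    by (simp add: mult.commute)
  then have 1: "((\<lambda>t. g t * f (x - t)) has_integral integral (cbox a b) (\<lambda>t. f t * g (x - t))) UNIV"
  proof (rule has_integral_on_superset)
    fix t assume t: "t \<notin> cbox (x - b) (x - a)"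
    have "x - t \<notin> cbox a b"
    proof
      assume "x - t \<in> cbox a b"
      then have "t \<in> cbox (x - b) (x - a)"
        by (auto simp: mem_box inner_diff_left algebra_simps)
      with t show False ..
    qed
    then show "g t * f (x - t) = 0" by (simp add: f0)
  qed auto
  have "(\<lambda>t. g t * f (x - t)) integrable_on cbox c d"
    by (intro integrable_continuous continuous_intros continuous_on_compose2[OF f]
          continuous_on_subset[OF g]) auto
  then have "((\<lambda>t. g t * f (x - t)) has_integral integral (cbox c d) (\<lambda>t. g t * f (x - t))) (cbox c d)"
    by (rule integrable_integral)
  then have 2: "((\<lambda>t. g t * f (x - t)) has_integral integral (cbox c d) (\<lambda>t. g t * f (x - t))) UNIV"
    by (rule has_integral_on_superset) (auto simp: g0)
  from 1 2 show ?thesis by (rule has_integral_unique)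
qed

lemma smooth_bump_algebra: "f \<in> bump_algebra r \<Longrightarrow> smooth f"
  unfolding smooth_def using bump_algebra_differentiable iter_partial_bump_algebra by blast

section \<open>Mollification and extension of the weak identity to C^1 functions\<close>

text \<open>A radial bump divided by its mass. As \<open>\<epsilon>\<close> is at most 1, the box of
  integration contains the ball outside which the function vanishes, and it can stay the same for
  all \<open>\<epsilon>\<close>.\<close>

lemma mollifier_exists:
  fixes \<epsilon> :: real
  assumes "0 < \<epsilon>" "\<epsilon> \<le> 1"
  obtains \<rho> :: "'a::euclidean_space \<Rightarrow> real"
  where "smooth \<rho>" "\<And>x. 0 \<le> \<rho> x" "\<And>x. \<epsilon> \<le> norm x \<Longrightarrow> \<rho> x = 0"
    "(\<rho> has_integral 1) (cbox (-One) One)"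
proof -
  define f :: "'a \<Rightarrow> real" where "f = (\<lambda>x. exp_bump 0 (\<epsilon>\<^sup>2 - x \<bullet> x))"
  have alg: "f \<in> bump_algebra (\<epsilon>\<^sup>2)" unfolding f_def by (rule bump_algebra.bump)
  then have cont: "continuous_on S f" for S
    using continuous_on_differentiable[of f] bump_algebra_differentiable continuous_on_subset by blast
  have nonneg: "0 \<le> f x" for x by (simp add: f_def exp_bump_def)
  define c where "c = integral (cbox (-One) One) f"
  have c: "(f has_integral c) (cbox (-One) One)"
    unfolding c_def by (intro integrable_integral integrable_continuous cont)
  \<comment> \<open>With zero mass the continuous nonnegative \<open>f\<close> would vanish at the
    origin, where its value is an exponential.\<close>
  have "c \<noteq> 0"
  proof
    assume "c = 0"
    have "0 \<in> box (-One) (One :: 'a)" by (simp add: mem_box)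
    have "f 0 = 0"
    proof (rule has_integral_0_cbox_imp_0[of "-One" One f])
      show "(f has_integral 0) (cbox (-One) One)" using c \<open>c = 0\<close> by simp
    qed (use \<open>0 \<in> box (-One) One\<close> in \<open>auto simp: cont nonneg intro: box_subset_cbox[THEN subsetD]\<close>)
    then show False using assms by (simp add: f_def exp_bump_def split: if_splits)
  qed
  moreover have "0 \<le> c" using has_integral_nonneg[OF c] nonneg by blast
  ultimately have "0 < c" by simp
  show thesis
  proof (rule that[of "\<lambda>x. inverse c * f x"])
    show "smooth (\<lambda>x. inverse c * f x)"
      by (rule smooth_bump_algebra[OF bump_algebra.mult[OF bump_algebra.const alg]])
    show "0 \<le> inverse c * f x" for x using nonneg \<open>0 < c\<close> by simp
    show "inverse c * f x = 0" if "\<epsilon> \<le> norm x" for x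
    proof -
      have "\<epsilon>\<^sup>2 \<le> (norm x)\<^sup>2" using that assms by (intro power_mono) auto
      then show ?thesis by (simp add: f_def exp_bump_def power2_norm_eq_inner)
    qed
    show "((\<lambda>x. inverse c * f x) has_integral 1) (cbox (-One) One)"
      using has_integral_mult_right[OF c, of "inverse c"] \<open>0 < c\<close> by simp
  qed
qed

lemma grad_eq_0_outside:
  assumes "closed K" "\<And>x. x \<notin> K \<Longrightarrow> f x = 0" "x \<notin> K"
  shows "grad f x = 0"
proof (rule grad_eqI)
  show "(f has_derivative (\<lambda>h. 0 \<bullet> h)) (at x)"
    by (rule has_derivative_transform_within_open[of "\<lambda>_. 0" _ _ _ "- K"]) (use assms in auto)
qed

lemma support_subset:
  assumes "closed K" "\<And>x. x \<notin> K \<Longrightarrow> f x = 0"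
  shows "support f \<subseteq> K"
  unfolding support_def by (rule closure_minimal) (use assms in auto)

text \<open>Mollify at a scale given by the uniform continuity of \<open>grad \<psi>\<close>. The
  gradients are then confined to the unit neighbourhood of \<open>K\<close>, a set that does not
  depend on \<open>e\<close>; this allows \<open>e\<close> to tend to 0 later.\<close>

lemma C1_approx_by_test_function:
  fixes \<psi> :: "'a::euclidean_space \<Rightarrow> real"
  assumes \<psi>: "\<And>x. \<psi> differentiable (at x)" and G: "continuous_on UNIV (grad \<psi>)"
    and K: "compact K" and \<psi>0: "\<And>x. x \<notin> K \<Longrightarrow> \<psi> x = 0" and "0 < e"
  shows "\<exists>\<eta>. test_function \<eta> \<and> (\<forall>x. norm (grad \<psi> x - grad \<eta> x) \<le> e)
    \<and> (\<forall>x. x \<notin> {s + t |s t. s \<in> K \<and> t \<in> cball 0 1} \<longrightarrow> grad \<eta> x = 0)"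
proof -
  define L where "L = {s + t |s t. s \<in> K \<and> t \<in> cball (0::'a) 1}"
  \<comment> \<open>One unit larger again: for \<open>x\<close> in \<open>L\<close> and
    \<open>norm t < \<epsilon>\<close>, the point \<open>x - t\<close> still lies where uniform
    continuity is available.\<close>
  define L2 where "L2 = {s + t |s t. s \<in> L \<and> t \<in> cball (0::'a) 1}"
  have L: "compact L" unfolding L_def by (rule compact_sums[OF K compact_cball])
  then have L2: "compact L2" unfolding L2_def by (rule compact_sums[OF _ compact_cball])
  have KL: "K \<subseteq> L"
  proof
    fix x assume "x \<in> K"
    then have "x + 0 \<in> L" unfolding L_def by (intro CollectI exI[of _ x] exI[of _ 0]) auto
    then show "x \<in> L" by simp
  qed
  have "uniformly_continuous_on L2 (grad \<psi>)"
    by (intro compact_uniformly_continuous L2 continuous_on_subset[OF G]) auto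
  then obtain \<delta> where \<delta>: "0 < \<delta>"
    "\<And>x y. x \<in> L2 \<Longrightarrow> y \<in> L2 \<Longrightarrow> dist y x < \<delta> \<Longrightarrow> dist (grad \<psi> y) (grad \<psi> x) < e"
    using \<open>0 < e\<close> unfolding uniformly_continuous_on_def by metis
  define \<epsilon> where "\<epsilon> = min \<delta> 1"
  have \<epsilon>: "0 < \<epsilon>" "\<epsilon> \<le> 1" "\<epsilon> \<le> \<delta>" using \<delta> by (auto simp: \<epsilon>_def)
  obtain \<rho> :: "'a \<Rightarrow> real" where \<rho>: "smooth \<rho>" "\<And>x. 0 \<le> \<rho> x" "\<And>x. \<epsilon> \<le> norm x \<Longrightarrow> \<rho> x = 0"
    "(\<rho> has_integral 1) (cbox (-One) One)"
    using mollifier_exists[OF \<epsilon>(1,2)] by blast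
  have \<rho>c: "continuous_on UNIV \<rho>"
    using \<rho>(1) unfolding smooth_def by (intro continuous_on_differentiable) (metis empty_subsetI iter_partial.simps(1) list.set(1))
  have \<psi>c: "continuous_on UNIV \<psi>" using \<psi> by (rule continuous_on_differentiable)
  have \<rho>0: "\<rho> t = 0" if "t \<notin> cbox (-One) One" for t
  proof (rule \<rho>(3), rule ccontr)
    assume "\<not> \<epsilon> \<le> norm t"
    then have "\<bar>t \<bullet> b\<bar> \<le> 1" if "b \<in> Basis" for b
      using Basis_le_norm[OF that, of t] \<epsilon> by linarith
    then have "t \<in> cbox (-One) One" by (auto simp: mem_box abs_le_iff minus_le_iff)
    with that show False ..
  qed
  obtain a where a: "K \<subseteq> cbox (-a) a"
    using bounded_subset_cbox_symmetric compact_imp_bounded[OF K] by blast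
  define \<eta> where "\<eta> = (\<lambda>x. integral (cbox (-a) a) (\<lambda>t. \<psi> t * \<rho> (x - t)))"
  \<comment> \<open>The definition has the mollifier under the derivative and gives smoothness; this
    form has \<open>\<psi>\<close> there and gives the gradient as an average of
    \<open>grad \<psi>\<close>.\<close>
  have \<eta>_eq: "\<eta> = (\<lambda>x. integral (cbox (-One) One) (\<lambda>t. \<rho> t * \<psi> (x - t)))"
    unfolding \<eta>_def by (intro ext convolution_commute \<psi>c \<rho>c \<rho>0 \<psi>0) (use a in auto)
  have "grad \<eta> x = integral (cbox (-One) One) (\<lambda>t. \<rho> t *\<^sub>R grad \<psi> (x - t))" for x
    unfolding \<eta>_eq by (intro grad_eqI convolution_has_derivative grad_inner \<psi> G \<rho>c)
  note grad_\<eta> = this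
  have \<eta>0: "\<eta> x = 0" if "x \<notin> L" for x
  proof -
    have "\<psi> t * \<rho> (x - t) = 0" for t
    proof (cases "t \<in> K")
      case True
      have "x - t \<notin> cball 0 1"
      proof
        assume "x - t \<in> cball 0 1"
        with True have "t + (x - t) \<in> L" unfolding L_def by blast
        with that show False by simp
      qed
      then show ?thesis using \<epsilon> \<rho>(3)[of "x - t"] by simp
    qed (simp add: \<psi>0)
    then have "(\<lambda>t. \<psi> t * \<rho> (x - t)) = (\<lambda>_. 0)" by (rule ext)
    then show ?thesis by (simp only: \<eta>_def integral_0)
  qed
  have cl: "closed L" "closed K" using L K by (auto intro: compact_imp_closed)
  have grad_\<eta>0: "grad \<eta> x = 0" if "x \<notin> L" for x
    by (rule grad_eq_0_outside[OF cl(1) _ that]) (rule \<eta>0)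
  show ?thesis
  proof (intro exI[of _ \<eta>] conjI allI impI)
    have "support \<eta> \<subseteq> L" by (rule support_subset[OF cl(1)]) (rule \<eta>0)
    then have "compact (support \<eta>)"
      using L by (simp add: support_def compact_closure) (meson bounded_subset closure_subset compact_imp_bounded order_trans)
    moreover have "smooth \<eta>" unfolding \<eta>_def by (intro smooth_convolution \<rho> \<psi>c)
    ultimately show "test_function \<eta>" by (simp add: test_function_def smooth_def)
  next
    fix x
    show "norm (grad \<psi> x - grad \<eta> x) \<le> e"
    proof (cases "x \<in> L")
      case False
      then have "x \<notin> K" using KL by blast
      then have "grad \<psi> x = 0" by (intro grad_eq_0_outside[OF cl(2)] \<psi>0)
      then show ?thesis using grad_\<eta>0[OF False] \<open>0 < e\<close> by simp
    next
      case True
      have i1: "(\<lambda>t. \<rho> t *\<^sub>R grad \<psi> (x - t)) integrable_on cbox (-One) One"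
        by (intro integrable_continuous continuous_intros continuous_on_compose2[OF G]
          continuous_on_subset[OF \<rho>c]) auto
      \<comment> \<open>Mass one makes \<open>grad \<psi> x\<close> an average as well, so the
        difference of the gradients is an average of oscillations over a ball of radius
        \<open>\<epsilon>\<close>.\<close>
      have i2: "((\<lambda>t. \<rho> t *\<^sub>R grad \<psi> x) has_integral grad \<psi> x) (cbox (-One) One)"
        using has_integral_scaleR_left[OF \<rho>(4)] by simp
      have i3: "((\<lambda>t. \<rho> t * e) has_integral e) (cbox (-One) One)"
        using has_integral_mult_left[OF \<rho>(4)] by simp
      have "grad \<psi> x - grad \<eta> x = integral (cbox (-One) One) (\<lambda>t. \<rho> t *\<^sub>R grad \<psi> x - \<rho> t *\<^sub>R grad \<psi> (x - t))"
        unfolding grad_\<eta> using i1 i2 by (simp add: integral_diff has_integral_iff)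
      also have "norm \<dots> \<le> integral (cbox (-One) One) (\<lambda>t. \<rho> t * e)"
      proof (rule integral_norm_bound_integral)
        fix t
        show "norm (\<rho> t *\<^sub>R grad \<psi> x - \<rho> t *\<^sub>R grad \<psi> (x - t)) \<le> \<rho> t * e"
        proof (cases "norm t < \<epsilon>")
          case False
          then show ?thesis using \<rho>(3)[of t] by simp
        next
          case t: True
          have "x + (- t) \<in> L2" unfolding L2_def using True t \<epsilon> by (intro CollectI exI[of _ x] exI[of _ "-t"]) auto
          moreover have "x + 0 \<in> L2" unfolding L2_def using True by (intro CollectI exI[of _ x] exI[of _ 0]) auto
          ultimately have "norm (grad \<psi> x - grad \<psi> (x - t)) \<le> e"
            using \<delta>(2)[of "x - t" x] t \<epsilon> by (simp add: dist_norm)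
          then show ?thesis
            using \<rho>(2)[of t] by (simp add: mult_left_mono flip: scaleR_diff_right)
        qed
      qed (use i1 i2 i3 in \<open>auto intro!: integrable_diff\<close>)
      also have "\<dots> = e" using i3 by (rule integral_unique)
      finally show ?thesis .
    qed
  qed (use grad_\<eta>0 in \<open>simp add: L_def\<close>)
qed

text \<open>On a fixed box \<open>V\<close> is bounded, so replacing \<open>grad \<psi>\<close> by a
  uniformly close gradient of a test function changes the integral by at most a constant times the
  error.\<close>

lemma weak_identity_C1:
  fixes V :: "'a::euclidean_space \<Rightarrow> 'a"
  assumes V: "continuous_on UNIV V"
    and test: "\<And>\<eta>. test_function \<eta> \<Longrightarrow> ((\<lambda>y. V y \<bullet> grad \<eta> y) has_integral 0) UNIV"
    and \<psi>: "\<And>x. \<psi> differentiable (at x)" and G: "continuous_on UNIV (grad \<psi>)"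
    and K: "compact K" and \<psi>0: "\<And>x. x \<notin> K \<Longrightarrow> \<psi> x = 0"
  shows "((\<lambda>y. V y \<bullet> grad \<psi> y) has_integral 0) UNIV"
proof -
  define L where "L = {s + t |s t. s \<in> K \<and> t \<in> cball (0::'a) 1}"
  have L: "compact L" unfolding L_def by (rule compact_sums[OF K compact_cball])
  have KL: "K \<subseteq> L"
  proof
    fix x assume "x \<in> K"
    then have "x + 0 \<in> L" unfolding L_def by (intro CollectI exI[of _ x] exI[of _ 0]) auto
    then show "x \<in> L" by simp
  qed
  obtain a where a: "L \<subseteq> cbox (-a) a"
    using bounded_subset_cbox_symmetric compact_imp_bounded[OF L] by blast
  let ?B = "cbox (-a) a"
  have grad0: "grad \<psi> x = 0" if "x \<notin> ?B" for x
    by (rule grad_eq_0_outside[OF compact_imp_closed[OF K]], rule \<psi>0) (use that KL a in blast)+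
  have "bounded (V ` ?B)"
    by (intro compact_imp_bounded compact_continuous_image continuous_on_subset[OF V]) auto
  then obtain M where M: "0 < M" "\<And>x. x \<in> ?B \<Longrightarrow> norm (V x) \<le> M"
    unfolding bounded_pos by auto
  define I where "I = integral ?B (\<lambda>y. V y \<bullet> grad \<psi> y)"
  have I: "((\<lambda>y. V y \<bullet> grad \<psi> y) has_integral I) ?B"
    unfolding I_def by (intro integrable_integral integrable_continuous continuous_intros
        continuous_on_subset[OF V] continuous_on_subset[OF G]) auto
  have "\<bar>I\<bar> \<le> e * (M * measure lborel ?B)" if "0 < e" for e
  proof -
    have "\<exists>\<eta>. test_function \<eta> \<and> (\<forall>x. norm (grad \<psi> x - grad \<eta> x) \<le> e)
      \<and> (\<forall>x. x \<notin> L \<longrightarrow> grad \<eta> x = 0)"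
      unfolding L_def by (rule C1_approx_by_test_function[OF \<psi> G K \<psi>0 \<open>0 < e\<close>])
    then obtain \<eta> where \<eta>: "test_function \<eta>" "\<And>x. norm (grad \<psi> x - grad \<eta> x) \<le> e"
      "\<And>x. x \<notin> L \<Longrightarrow> grad \<eta> x = 0"
      by blast
    have \<eta>0: "grad \<eta> y = 0" if "y \<notin> ?B" for y
      using \<eta>(3) that a by blast
    have "((\<lambda>y. if y \<in> ?B then V y \<bullet> grad \<eta> y else 0) has_integral 0) UNIV"
      by (rule has_integral_eq[OF _ test[OF \<eta>(1)]]) (simp add: \<eta>0)
    then have "((\<lambda>y. V y \<bullet> grad \<eta> y) has_integral 0) ?B"
      by (simp only: has_integral_restrict_UNIV)
    from has_integral_diff[OF I this]
    have "((\<lambda>y. V y \<bullet> (grad \<psi> y - grad \<eta> y)) has_integral I) ?B"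
      by (simp add: inner_diff_right)
    then have "norm I \<le> M * e * measure lborel ?B"
    proof (rule has_integral_bound[rotated])
      fix y assume "y \<in> ?B"
      have "norm (V y \<bullet> (grad \<psi> y - grad \<eta> y)) \<le> norm (V y) * norm (grad \<psi> y - grad \<eta> y)"
        by (simp add: Cauchy_Schwarz_ineq2)
      also have "\<dots> \<le> M * e" using M \<open>y \<in> ?B\<close> \<eta>(2) by (intro mult_mono) auto
      finally show "norm (V y \<bullet> (grad \<psi> y - grad \<eta> y)) \<le> M * e" .
    qed (use M \<open>0 < e\<close> in auto)
    then show ?thesis by (simp add: mult_ac)
  qed
  note * = this
  have "I = 0"
  proof (rule ccontr)
    assume "I \<noteq> 0"
    define q where "q = M * measure lborel ?B"
    have q: "0 \<le> q" using M by (simp add: q_def)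
    \<comment> \<open>The error \<open>e = \<bar>I\<bar> / (q + 1)\<close> makes the bound strictly
      smaller than \<open>\<bar>I\<bar>\<close>, even when \<open>q = 0\<close>.\<close>
    have "\<bar>I\<bar> \<le> \<bar>I\<bar> / (q + 1) * q"
      unfolding q_def using \<open>I \<noteq> 0\<close> q[unfolded q_def] by (intro *) (simp add: add_nonneg_pos)
    moreover have "\<bar>I\<bar> * (q / (q + 1)) < \<bar>I\<bar> * 1"
      by (rule mult_strict_left_mono) (use q \<open>I \<noteq> 0\<close> in auto)
    ultimately show False by (simp only: times_divide_eq_left times_divide_eq_right mult_1_right not_le)
  qed
  with I have "((\<lambda>y. V y \<bullet> grad \<psi> y) has_integral 0) ?B" by (simp only:)
  then show ?thesis
  proof (rule has_integral_on_superset)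
    show "V x \<bullet> grad \<psi> x = 0" if "x \<notin> ?B" for x
      using grad0[OF that] by (simp only: inner_zero_right)
  qed (rule subset_UNIV)
qed

section \<open>Pointwise vanishing of the flux\<close>

text \<open>Squaring the truncation makes it C^1 across the level \<open>M\<close>, and its gradient
  is \<open>-2 h grad u\<close>. Testing with it therefore produces an integrand of one sign, which
  must vanish by continuity.\<close>

lemma gradient_flow_stationary:
  fixes u \<Phi> :: "'a::euclidean_space \<Rightarrow> real"
  assumes \<Phi>: "continuous_on UNIV \<Phi>" "\<And>y. 0 \<le> \<Phi> y"
    and u: "\<And>x. u differentiable (at x)" and G: "continuous_on UNIV (grad u)"
    and coercive: "\<And>M. bounded {x. u x \<le> M}"
    and weak: "\<And>\<eta>. test_function \<eta> \<Longrightarrow> ((\<lambda>y. (\<Phi> y *\<^sub>R grad u y) \<bullet> grad \<eta> y) has_integral 0) UNIV"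
  shows "\<Phi> x *\<^sub>R grad u x = 0"
proof -
  \<comment> \<open>This level gives \<open>h x = 1\<close>, so the factor \<open>h\<close>
    disappears at the point of interest.\<close>
  define M where "M = u x + 1"
  define h where "h = (\<lambda>y. max 0 (M - u y))"
  have uc: "continuous_on S u" for S
    using continuous_on_differentiable[OF u] continuous_on_subset by blast
  have hc: "continuous_on S h" for S
    unfolding h_def by (intro continuous_intros uc)
  have Gc: "continuous_on S (grad u)" for S using G continuous_on_subset by blast
  have \<Phi>c: "continuous_on S \<Phi>" for S using \<Phi> continuous_on_subset by blast
  have sq: "((\<lambda>t. (max 0 (M - t))\<^sup>2) has_real_derivative - 2 * max 0 (M - t)) (at t)" for t :: real
  proof -
    consider "t < M" | "t > M" | "t = M" by linarith
    then show ?thesis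
    proof cases
      case 1
      have "((\<lambda>t. (M - t)\<^sup>2) has_real_derivative - 2 * max 0 (M - t)) (at t)"
        using 1 by (auto intro!: derivative_eq_intros)
      then show ?thesis
        by (rule has_field_derivative_transform_within_open[of _ _ _ "{..<M}"]) (use 1 in auto)
    next
      case 2
      have "((\<lambda>t. 0) has_real_derivative - 2 * max 0 (M - t)) (at t)"
        using 2 by auto
      then show ?thesis
        by (rule has_field_derivative_transform_within_open[of _ _ _ "{M<..}"]) (use 2 in auto)
    next
      case 3
      \<comment> \<open>At the kink the difference quotient is \<open>(max 0 (- d))^2 / d\<close>,
        dominated by \<open>\<bar>d\<bar>\<close>.\<close>
      have "((\<lambda>d. \<bar>d\<bar>) \<longlongrightarrow> 0) (at (0::real))"
        using tendsto_rabs[OF tendsto_ident_at[of "0::real" UNIV]] by simp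
      then have "((\<lambda>d. (max 0 (- d))\<^sup>2 / d) \<longlongrightarrow> 0) (at (0::real))"
        by (rule Lim_null_comparison[rotated])
           (auto simp: eventually_at_filter max_def power2_eq_square)
      then show ?thesis unfolding DERIV_def using 3 by simp
    qed
  qed
  have "((\<lambda>y. (h y)\<^sup>2) has_derivative (\<lambda>d. (- 2 * h y) *\<^sub>R grad u y \<bullet> d)) (at y)" for y
    using has_derivative_compose[OF grad_inner[OF u] sq[unfolded has_field_derivative_def], of y]
    by (simp add: h_def mult.commute)
  then have diff: "(\<lambda>y. (h y)\<^sup>2) differentiable (at y)"
    and grad: "grad (\<lambda>y. (h y)\<^sup>2) y = (- 2 * h y) *\<^sub>R grad u y" for y
    by (auto simp: differentiable_def intro!: grad_eqI)
  have "closed {x. u x \<le> M}"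
    using uc by (intro closed_Collect_le continuous_intros) auto
  then have K: "compact {x. u x \<le> M}" using coercive by (simp add: compact_eq_bounded_closed)
  have V: "continuous_on UNIV (\<lambda>y. \<Phi> y *\<^sub>R grad u y)" by (intro continuous_intros \<Phi>c Gc)
  have "((\<lambda>y. (\<Phi> y *\<^sub>R grad u y) \<bullet> grad (\<lambda>y. (h y)\<^sup>2) y) has_integral 0) UNIV"
  proof (rule weak_identity_C1[OF V weak diff _ K])
    show "continuous_on UNIV (grad (\<lambda>y. (h y)\<^sup>2))"
      unfolding ext[of "grad (\<lambda>y. (h y)\<^sup>2)", OF grad] by (intro continuous_intros hc Gc)
  qed (auto simp: h_def)
  then have "((\<lambda>y. -2 * (\<Phi> y * h y * (grad u y \<bullet> grad u y))) has_integral 0) UNIV"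
    by (simp add: grad mult_ac)
  from has_integral_mult_right[OF this, of "-1/2"]
  have int: "((\<lambda>y. \<Phi> y * h y * (grad u y \<bullet> grad u y)) has_integral 0) UNIV" by simp
  obtain a where a: "{x. u x \<le> M} \<subseteq> cbox (-a) a"
    using bounded_subset_cbox_symmetric[OF coercive] by blast
  \<comment> \<open>The margin \<open>One\<close> ensures a nonempty interior, which is needed to
    conclude that a continuous nonnegative function with zero integral vanishes on the closed
    box.\<close>
  define B where "B = cbox (-a - One) (a + One)"
  have xb: "x \<in> box (-a - One) (a + One)"
  proof -
    have "x \<in> cbox (-a) a" using a by (auto simp: M_def)
    then show ?thesis by (force simp: mem_box inner_diff_left inner_add_left)
  qed
  have "h y = 0" if "y \<notin> B" for y
  proof -
    have "y \<notin> cbox (-a) a"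
      using that unfolding B_def by (force simp: mem_box inner_diff_left inner_add_left)
    then have "\<not> u y \<le> M" using a by auto
    then show ?thesis by (simp add: h_def)
  qed
  then have "((\<lambda>y. if y \<in> B then \<Phi> y * h y * (grad u y \<bullet> grad u y) else 0) has_integral 0) UNIV"
    by (intro has_integral_eq[OF _ int]) simp
  then have "((\<lambda>y. \<Phi> y * h y * (grad u y \<bullet> grad u y)) has_integral 0) B"
    by (simp only: has_integral_restrict_UNIV)
  then have "\<Phi> x * h x * (grad u x \<bullet> grad u x) = 0"
    unfolding B_def
  proof (rule has_integral_0_cbox_imp_0[rotated 2])
    show "x \<in> cbox (-a - One) (a + One)" using xb box_subset_cbox by blast
    show "box (-a - One) (a + One) \<noteq> {}" using xb by blast
    show "0 \<le> \<Phi> y * h y * (grad u y \<bullet> grad u y)" for y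
      using \<Phi> by (simp add: h_def)
  qed (intro continuous_intros \<Phi>c hc Gc)
  then show ?thesis by (simp add: h_def M_def)
qed

section \<open>Growth of the Riesz potential and coercivity\<close>

text \<open>Beyond 1 a power with exponent at most 1 grows no faster than the identity; the constant
  1 absorbs the range below. It serves the kernel with exponent \<open>2 * s - 1\<close>.\<close>

lemma powr_diff_le:
  fixes p q a :: real
  assumes "0 \<le> p" "0 \<le> q" "0 < a" "a \<le> 1" "p \<le> q + r" "0 \<le> r"
  shows "p powr a - q powr a \<le> 1 + r"
proof -
  consider "p \<le> q" | "q < p" "p \<le> 1" | "q < p" "1 < p" by linarith
  then show ?thesis
  proof cases
    case 1
    then have "p powr a \<le> q powr a" using assms by (intro powr_mono2) auto
    then show ?thesis using assms by linarith
  next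
    case 2
    then have "p powr a \<le> 1" using assms by (intro powr_le1) auto
    then show ?thesis using assms powr_ge_zero[of q a] by linarith
  next
    case 3
    \<comment> \<open>The base is below 1, so lowering the exponent increases the power; factoring
      out \<open>p powr a\<close> then compares with \<open>p - q\<close>.\<close>
    have "(q / p) powr 1 \<le> (q / p) powr a"
      using assms 3 by (intro powr_mono') auto
    then have "q / p \<le> (q / p) powr a" using assms 3 by simp
    then have "p powr a * (1 - (q / p) powr a) \<le> p powr a * (1 - q / p)"
      by (intro mult_left_mono) auto
    also have "\<dots> \<le> p powr 1 * (1 - q / p)"
      using assms 3 by (intro mult_right_mono powr_mono) auto
    also have "\<dots> = p - q" using 3 by (simp add: field_simps)
    finally have "p powr a - q powr a \<le> p - q"
      using 3 assms by (simp add: powr_divide right_diff_distrib)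
    then show ?thesis using assms by linarith
  qed
qed

text \<open>For N > 2s the kernel is nonnegative. Otherwise N = 1, and the renormalised kernel
  decreases at most linearly in \<open>x\<close>, up to a logarithmic singularity in
  \<open>y\<close> when s = 1/2.\<close>

lemma riesz_potential_lower_bound:
  fixes f :: "'a::euclidean_space \<Rightarrow> real"
  assumes s: "0 < s" "s < 1" and f0: "\<And>y. 0 \<le> f y" and f: "integrable lebesgue f"
    and k: "\<And>x. integrable lebesgue (\<lambda>y. riesz_kernel DIM('a) s (x - y) y * f y)"
  obtains C where "0 \<le> C" "\<And>x. - C * (1 + norm x) \<le> riesz_potential s f x"
proof -
  let ?I = "\<integral>y. f y \<partial>lebesgue"
  have I: "0 \<le> ?I" by (simp add: f0)
  consider "real DIM('a) > 2 * s" | "\<not> real DIM('a) > 2 * s" "2 * s = 1"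
    | "\<not> real DIM('a) > 2 * s" "2 * s \<noteq> 1" by blast
  then show thesis
  proof cases
    case 1
    have "0 \<le> riesz_kernel DIM('a) s (x - y) y" for x y :: 'a
    proof -
      have "0 < Gamma (real DIM('a) / 2 - s)" "0 < Gamma s"
        using 1 s by (auto intro!: Gamma_real_pos)
      then show ?thesis using 1 by (simp add: riesz_kernel_def)
    qed
    then have "0 \<le> riesz_potential s f x" for x
      unfolding riesz_potential_def by (simp add: f0)
    then show thesis by (intro that[of 0]) auto
  next
    case 2
    \<comment> \<open>The singularity at \<open>y = 0\<close> brought in by renormalising the
      kernel. It admits no bound uniform in \<open>y\<close>, so its integrability against
      \<open>f\<close> has to be proved.\<close>
    define w where "w = (\<lambda>y::'a. indicator (cball 0 1) y * (- ln (norm y)))"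
    have w0: "0 \<le> w y" for y
      by (cases "y = 0") (auto simp: w_def indicator_def)
    have kernel: "riesz_kernel DIM('a) s z y = - (1 / pi) * (ln (norm z) - ln (norm y))" for z y :: 'a
      using 2 by (simp add: riesz_kernel_def)
    obtain b :: 'a where b: "b \<in> Basis" using nonempty_Basis by blast
    \<comment> \<open>Seen from a point of norm 2, the unit ball lies at distance between 1 and 3.
      There the kernel at \<open>x0\<close> controls \<open>- ln (norm y)\<close> up to
      \<open>ln 3\<close>, and the assumed integrability at this one point suffices.\<close>
    define x0 where "x0 = 2 *\<^sub>R b"
    have x0: "norm x0 = 2" using b by (simp add: x0_def)
    have wf: "integrable lebesgue (\<lambda>y. w y * f y)"
    proof (rule Bochner_Integration.integrable_bound)
      show "integrable lebesgue (\<lambda>y. pi * \<bar>riesz_kernel DIM('a) s (x0 - y) y * f y\<bar> + ln 3 * f y)"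
        using k[of x0] f by auto
      have "w \<in> borel_measurable lebesgue"
        unfolding w_def
        by (intro measurable_completion borel_measurable_times borel_measurable_indicator
            borel_measurable_uminus borel_measurable_ln borel_measurable_norm) auto
      then show "(\<lambda>y. w y * f y) \<in> borel_measurable lebesgue"
        using f by (intro borel_measurable_times) auto
      show "AE y in lebesgue. norm (w y * f y) \<le> norm (pi * \<bar>riesz_kernel DIM('a) s (x0 - y) y * f y\<bar> + ln 3 * f y)"
      proof (rule AE_I2)
        fix y :: 'a
        have "w y \<le> pi * \<bar>riesz_kernel DIM('a) s (x0 - y) y\<bar> + ln 3"
        proof (cases "norm y \<le> 1")
          case True
          have "norm x0 \<le> norm (x0 - y) + norm y" "norm (x0 - y) \<le> norm x0 + norm y"
            using norm_triangle_sub[of x0 y] norm_triangle_ineq4[of x0 y] by auto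
          then have "1 \<le> norm (x0 - y)" "norm (x0 - y) \<le> 3" using x0 True by auto
          then have "0 \<le> ln (norm (x0 - y))" "ln (norm (x0 - y)) \<le> ln 3"
            by (auto simp del: ln_le_cancel_iff intro!: ln_ge_zero iffD2[OF ln_le_cancel_iff])
          then have "- ln (norm y) \<le> \<bar>ln (norm (x0 - y)) - ln (norm y)\<bar> + ln 3" by linarith
          also have "\<bar>ln (norm (x0 - y)) - ln (norm y)\<bar> = pi * \<bar>riesz_kernel DIM('a) s (x0 - y) y\<bar>"
            unfolding kernel by (simp add: abs_mult)
          finally show ?thesis using True by (simp add: w_def)
        qed (simp add: w_def)
        then have "w y * f y \<le> (pi * \<bar>riesz_kernel DIM('a) s (x0 - y) y\<bar> + ln 3) * f y"
          by (intro mult_right_mono f0)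
        then show "norm (w y * f y) \<le> norm (pi * \<bar>riesz_kernel DIM('a) s (x0 - y) y * f y\<bar> + ln 3 * f y)"
          using w0[of y] f0[of y] by (simp add: abs_mult algebra_simps)
      qed
    qed
    define C where "C = (1 / pi) * (?I + (\<integral>y. w y * f y \<partial>lebesgue))"
    have J: "0 \<le> (\<integral>y. w y * f y \<partial>lebesgue)" by (simp add: w0 f0)
    show thesis
    proof (rule that[of C])
      show "0 \<le> C" using I J by (simp add: C_def)
      fix x :: 'a
      have bound: "ln (norm (x - y)) - ln (norm y) \<le> norm x + w y" for y
      proof -
        have tri: "norm (x - y) \<le> norm x + norm y" by (rule norm_triangle_ineq4)
        \<comment> \<open>The convention \<open>ln 0 = 0\<close> makes \<open>y = 0\<close> and
          \<open>x = y\<close> separate cases. For small \<open>y\<close> the estimate uses ln r <=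
          r - 1, for large \<open>y\<close> it uses |x - y| <= (1 + |x|) |y|.\<close>
        consider "y = 0" | "y \<noteq> 0" "x = y" | "y \<noteq> 0" "x \<noteq> y" "norm y \<le> 1" | "y \<noteq> 0" "x \<noteq> y" "1 < norm y"
          by linarith
        then show ?thesis
        proof cases
          case 1
          then show ?thesis using w0[of y] ln_le_minus_one[of "norm x"] by (cases "x = 0") auto
        next
          case 2
          show ?thesis
          proof (cases "norm y \<le> 1")
            case True
            with 2 show ?thesis by (simp add: w_def)
          next
            case False
            then have "0 \<le> ln (norm y)" by (intro ln_ge_zero) simp
            then have "- ln (norm y) \<le> norm x + w y" using w0[of y] norm_ge_zero[of x] by linarith
            with 2 show ?thesis by simp
          qed
        next
          case 3
          then show ?thesis using tri ln_le_minus_one[of "norm (x - y)"] by (simp add: w_def)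
        next
          case 4
          have "norm (x - y) \<le> norm x * norm y + norm y"
            using tri 4 mult_left_mono[of 1 "norm y" "norm x"] by simp
          then have "ln (norm (x - y)) \<le> ln ((1 + norm x) * norm y)"
            using 4 by (subst ln_le_cancel_iff) (auto simp: algebra_simps add_pos_nonneg)
          also have "\<dots> = ln (1 + norm x) + ln (norm y)"
            using 4 by (intro ln_mult_pos) (auto simp: add_pos_nonneg)
          also have "ln (1 + norm x) \<le> norm x" by (rule ln_add_one_self_le_self) simp
          finally show ?thesis using 4 by (simp add: w_def)
        qed
      qed
      have "- C * (1 + norm x) \<le> - (1 / pi) * (norm x * ?I + (\<integral>y. w y * f y \<partial>lebesgue))"
        using I J by (simp add: C_def field_simps)
      also have "\<dots> = (\<integral>y. - (1 / pi) * (norm x * f y + w y * f y) \<partial>lebesgue)"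
        using f wf by simp
      also have "\<dots> \<le> riesz_potential s f x"
        unfolding riesz_potential_def
      proof (rule integral_mono[OF _ k])
        show "integrable lebesgue (\<lambda>y. - (1 / pi) * (norm x * f y + w y * f y))"
          using f wf by auto
        fix y
        have "(1 / pi) * ((ln (norm (x - y)) - ln (norm y)) * f y) \<le> (1 / pi) * ((norm x + w y) * f y)"
          by (intro mult_left_mono mult_right_mono bound f0) auto
        then show "- (1 / pi) * (norm x * f y + w y * f y) \<le> riesz_kernel DIM('a) s (x - y) y * f y"
          unfolding kernel by (simp add: algebra_simps)
      qed
      finally show "- C * (1 + norm x) \<le> riesz_potential s f x" .
    qed
  next
    case 3
    have "1 \<le> real DIM('a)" using DIM_positive[where 'a='a] by linarith
    then have s2: "1 < 2 * s" using 3 by linarith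
    define c where "c = Gamma (1 / 2 - s) / (4 powr s * sqrt pi * Gamma s)"
    have kernel: "riesz_kernel DIM('a) s z y = c * (norm z powr (2 * s - 1) - norm y powr (2 * s - 1))" for z y :: 'a
      using 3 by (simp add: riesz_kernel_def c_def)
    \<comment> \<open>The argument lies strictly between -1/2 and 0, hence is no pole, and the
      functional equation of Gamma shows that \<open>c\<close> is not positive. An upper bound for
      the difference of powers thus becomes a lower bound for the kernel.\<close>
    have "1 / 2 - s \<notin> \<int>\<^sub>\<le>\<^sub>0"
    proof
      assume "1 / 2 - s \<in> \<int>\<^sub>\<le>\<^sub>0"
      then obtain n where n: "1 / 2 - s = real_of_int n" by (elim nonpos_Ints_cases)
      then have "real_of_int n < 0" "-1 < real_of_int n" using s s2 by linarith+
      then show False by simp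
    qed
    then have "Gamma (1 / 2 - s + 1) = (1 / 2 - s) * Gamma (1 / 2 - s)" by (rule Gamma_plus1)
    moreover have "0 < Gamma (1 / 2 - s + 1)" using s by (intro Gamma_real_pos) auto
    ultimately have "Gamma (1 / 2 - s) < 0" using s2 by (auto simp: zero_less_mult_iff)
    moreover have "0 < Gamma s" using s by (intro Gamma_real_pos) auto
    ultimately have c: "c \<le> 0" by (simp add: c_def divide_le_0_iff)
    show thesis
    proof (rule that[of "- c * ?I"])
      show "0 \<le> - c * ?I" using c I by (simp add: mult_nonpos_nonneg)
      fix x :: 'a
      have "- (- c * ?I) * (1 + norm x) = (\<integral>y. c * (1 + norm x) * f y \<partial>lebesgue)" by simp
      also have "\<dots> \<le> riesz_potential s f x"
        unfolding riesz_potential_def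
      proof (rule integral_mono[OF _ k])
        show "integrable lebesgue (\<lambda>y. c * (1 + norm x) * f y)" using f by simp
        fix y
        have "norm (x - y) powr (2 * s - 1) - norm y powr (2 * s - 1) \<le> 1 + norm x"
          using s s2 norm_triangle_ineq4[of x y] by (intro powr_diff_le) (auto simp: add.commute)
        then show "c * (1 + norm x) * f y \<le> riesz_kernel DIM('a) s (x - y) y * f y"
          unfolding kernel by (intro mult_right_mono mult_left_mono_neg c f0)
      qed
      finally show "- (- c * ?I) * (1 + norm x) \<le> riesz_potential s f x" .
    qed
  qed
qed

lemma bounded_sublevel_quadratic:
  fixes P :: "'a::real_inner \<Rightarrow> real"
  assumes "0 < \<beta>" "0 \<le> C" and P: "\<And>x. - C * (1 + norm x) \<le> P x"
  shows "bounded {x. P x + \<beta> / 2 * (x \<bullet> x) \<le> M}"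
proof (rule boundedI)
  fix x assume "x \<in> {x. P x + \<beta> / 2 * (x \<bullet> x) \<le> M}"
  then have *: "\<beta> / 2 * (norm x * norm x) \<le> M + C * (1 + norm x)"
    using P[of x] by (simp add: dot_square_norm power2_eq_square)
  \<comment> \<open>Beyond the unit ball the constants \<open>\<bar>M\<bar>\<close> and
    \<open>C\<close> may be multiplied by \<open>norm x\<close>; dividing by \<open>norm x\<close>
    leaves this radius, with 1 added for the ball itself.\<close>
  show "norm x \<le> 1 + 2 * (\<bar>M\<bar> + 2 * C) / \<beta>"
  proof (cases "norm x \<le> 1")
    case True
    then show ?thesis using assms by (simp add: add_increasing2)
  next
    case False
    have "\<bar>M\<bar> \<le> \<bar>M\<bar> * norm x" "C \<le> C * norm x"
      using False assms by (auto intro!: mult_left_le[of 1, simplified] simp: mult_le_cancel_left1)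
    with * have "(\<beta> / 2 * norm x) * norm x \<le> (\<bar>M\<bar> + 2 * C) * norm x"
      by (simp add: algebra_simps)
    then have "\<beta> / 2 * norm x \<le> \<bar>M\<bar> + 2 * C" by (rule mult_right_le_imp_le) (use False in linarith)
    then have "norm x \<le> 2 * (\<bar>M\<bar> + 2 * C) / \<beta>" using assms by (simp add: field_simps)
    then show ?thesis by simp
  qed
qed

section \<open>Transfer of the profile equation to the power nonlinearity\<close>

theorem theorem4p1:
  fixes \<Phi> \<phi>3 :: "'a::euclidean_space \<Rightarrow> real"
    and s m \<beta>2 \<beta>3 :: real
  assumes s: "0 < s" "s < 1"
    and \<beta>2: "\<beta>2 = 1 / (real DIM('a) + 2 - 2 * s)"
    and \<Phi>_nonneg: "\<forall>y. \<Phi> y \<ge> 0"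
    and \<Phi>_cont: "continuous_on UNIV \<Phi>"
    and \<Phi>_int: "integrable lebesgue \<Phi>"
    and \<Phi>_sol: "profile_solution s \<beta>2 \<Phi> \<Phi>"
    and m: "m > 1"
    and \<beta>3: "\<beta>3 = 1 / (real DIM('a) * (m - 1) + 2 - 2 * s)"
    and \<phi>3_nonneg: "\<forall>y. \<phi>3 y \<ge> 0"
    and \<phi>3_def: "\<forall>y. \<phi>3 y powr (m - 1) = (\<beta>3 / \<beta>2) * \<Phi> y"
  shows "profile_solution s \<beta>3 \<phi>3 (\<lambda>y. \<phi>3 y powr (m - 1))
         \<and> support \<phi>3 = support \<Phi>"
proof -
  define \<kappa> where "\<kappa> = \<beta>3 / \<beta>2"
  have \<beta>2_pos: "0 < \<beta>2" using s unfolding \<beta>2 by (simp add: add_pos_pos)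
  have "0 < real DIM('a) * (m - 1)" using m by simp
  then have \<beta>3_pos: "0 < \<beta>3" using s unfolding \<beta>3 by (intro divide_pos_pos) auto
  have \<kappa>: "0 < \<kappa>" "\<kappa> * \<beta>2 = \<beta>3" using \<beta>2_pos \<beta>3_pos by (auto simp: \<kappa>_def)
  have \<phi>3: "(\<lambda>y. \<phi>3 y powr (m - 1)) = (\<lambda>y. \<kappa> * \<Phi> y)"
    using \<phi>3_def by (simp add: \<kappa>_def)
  \<comment> \<open>A real power vanishes exactly when its base does, and \<open>\<kappa>\<close> is
    positive. Equal zero sets give equal supports at once.\<close>
  have zero: "\<phi>3 y = 0 \<longleftrightarrow> \<Phi> y = 0" for y
    using fun_cong[OF \<phi>3, of y] \<kappa> by (metis mult_eq_0_iff less_irrefl powr_eq_0_iff)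
  let ?P = "riesz_potential s \<Phi>"
  from \<Phi>_sol have k: "\<And>x. integrable lebesgue (\<lambda>y. riesz_kernel DIM('a) s (x - y) y * \<Phi> y)"
    and P: "\<And>x. ?P differentiable (at x)" and gP: "continuous_on UNIV (grad ?P)"
    and weak: "\<And>\<psi>. test_function \<psi> \<Longrightarrow> integrable lebesgue (\<lambda>y. \<Phi> y * ((grad ?P y + \<beta>2 *\<^sub>R y) \<bullet> grad \<psi> y))"
      "\<And>\<psi>. test_function \<psi> \<Longrightarrow> (\<integral>y. \<Phi> y * ((grad ?P y + \<beta>2 *\<^sub>R y) \<bullet> grad \<psi> y) \<partial>lebesgue) = 0"
    unfolding profile_solution_def by auto
  obtain C where C: "0 \<le> C" "\<And>x. - C * (1 + norm x) \<le> ?P x"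
    using riesz_potential_lower_bound[OF s _ \<Phi>_int k] \<Phi>_nonneg by blast
  \<comment> \<open>The drift \<open>\<beta>2 *\<^sub>R x\<close> is absorbed as the gradient of a
    quadratic, so the whole velocity is a gradient; positivity of \<open>\<beta>2\<close> gives
    coercivity.\<close>
  define u where "u = (\<lambda>x. ?P x + \<beta>2 / 2 * (x \<bullet> x))"
  have "(u has_derivative (\<lambda>h. (grad ?P x + \<beta>2 *\<^sub>R x) \<bullet> h)) (at x)" for x
    unfolding u_def using grad_inner[OF P, of x]
    by (auto intro!: derivative_eq_intros simp: inner_add_left inner_add_right inner_commute)
  then have u: "\<And>x. u differentiable (at x)" "grad u = (\<lambda>x. grad ?P x + \<beta>2 *\<^sub>R x)"
    by (auto simp: differentiable_def intro!: grad_eqI)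
  have stationary: "\<Phi> x *\<^sub>R grad u x = 0" for x
  proof (rule gradient_flow_stationary)
    show "bounded {x. u x \<le> M}" for M
      unfolding u_def by (rule bounded_sublevel_quadratic[OF \<beta>2_pos C])
    show "continuous_on UNIV (grad u)" unfolding u by (intro continuous_intros gP)
    show "((\<lambda>y. (\<Phi> y *\<^sub>R grad u y) \<bullet> grad \<psi> y) has_integral 0) UNIV" if "test_function \<psi>" for \<psi>
      using has_integral_integral_lebesgue[OF weak(1)[OF that]] weak(2)[OF that] by (simp add: u)
  qed (use \<Phi>_cont \<Phi>_nonneg u in auto)
  have pot: "riesz_potential s (\<lambda>y. \<phi>3 y powr (m - 1)) = (\<lambda>x. \<kappa> * ?P x)"
    unfolding \<phi>3 riesz_potential_def by (simp add: mult.left_commute[of _ \<kappa>])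
  have "((\<lambda>x. \<kappa> * ?P x) has_derivative (\<lambda>h. (\<kappa> *\<^sub>R grad ?P x) \<bullet> h)) (at x)" for x
    using grad_inner[OF P, of x] by (auto intro!: derivative_eq_intros)
  then have pot_diff: "\<And>x. (\<lambda>x. \<kappa> * ?P x) differentiable (at x)"
    and pot_grad: "grad (\<lambda>x. \<kappa> * ?P x) = (\<lambda>x. \<kappa> *\<^sub>R grad ?P x)"
    by (auto simp: differentiable_def intro!: grad_eqI)
  \<comment> \<open>The weak integrand is zero at every point, so its integrability and its zero
    integral hold for all test functions together.\<close>
  have flux: "\<phi>3 y * ((\<kappa> *\<^sub>R grad ?P y + \<beta>3 *\<^sub>R y) \<bullet> v) = 0" for y v
  proof (cases "\<Phi> y = 0")
    case False
    then have "grad ?P y + \<beta>2 *\<^sub>R y = 0" using stationary[of y] by (simp add: u)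
    then have "\<kappa> *\<^sub>R (grad ?P y + \<beta>2 *\<^sub>R y) = 0" by simp
    then have "\<kappa> *\<^sub>R grad ?P y + \<beta>3 *\<^sub>R y = 0" by (simp add: scaleR_add_right \<kappa>)
    then show ?thesis by simp
  qed (simp add: zero)
  have "profile_solution s \<beta>3 \<phi>3 (\<lambda>y. \<phi>3 y powr (m - 1))"
    unfolding profile_solution_def pot pot_grad
    using k pot_diff gP
    by (auto simp: fun_cong[OF \<phi>3] flux mult.left_commute[of _ \<kappa>] intro!: continuous_intros)
  then show ?thesis by (simp add: support_def zero)
qed

end
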